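(* Let $N, N_{\rm loc}\ge 1$ be integers and let $A,B,P\in\mathbb{R}^{N\times N}$, where $A$ is symmetric, $B$ is skew-symmetric and $P$ is symmetric positive definite. Suppose $$A=\sum_{k=1}^{N_{\rm loc}}A_k,\qquad B=\sum_{k=1}^{N_{\rm loc}}B_k,\qquad P=\sum_{k=1}^{N_{\rm loc}}P_k,$$ where, for each $k=1,\dots,N_{\rm loc}$, the matrices $A_k,B_k,P_k\in\mathbb{R}^{N\times N}$ are such that $P_k$ is symmetric positive semi-definite, $A_k$ is symmetric, $B_k$ is skew-symmetric, and $$\mathrm{Ker}(P_k)\subseteq \mathrm{Ker}(A_k),\qquad \mathrm{Ker}(P_k)\subseteq \mathrm{Ker}(B_k).$$ For $j=1,\dots,N$ let $S_{P,j}=\{k\in\{1,\dots,N_{\rm loc}\} : \text{row } j \text{ of } P_k \text{ is nonzero}\}$ and define $$(\alpha_{\min})_j=\min\{\lambda_{\rm ker,min}(P_k^{-1}A_k) : k\in S_{P,j}\},$$ $$(\alpha_{\max})_j=\max\{\lambda_{\rm ker,max}(P_k^{-1}A_k) : k\in S_{P,j}\},$$ $$(\beta_{\max})_j=\max\{\lambda_{\rm ker,im,max}(P_k^{-1}B_k) : k\in S_{P,j}\}.$$ Let $\mu+\mathrm{i}\xi$, with $\mu,\xi\in\mathbb{R}$, be an eigenvalue of $P^{-1}(A+B)$. Then $$\mu\in\Big[\min_{j=1,\dots,N}(\alpha_{\min})_j,\ \max_{j=1,\dots,N}(\alpha_{\max})_j\Big],\qquad \xi\in\Big[-\max_{j=1,\dots,N}(\beta_{\max})_j,\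 \max_{j=1,\dots,N}(\beta_{\max})_j\Big].$$
   Context: For a symmetric matrix $A_k$ and a symmetric positive semi-definite matrix $P_k\neq 0$ with $\mathrm{Ker}(P_k)\subseteq\mathrm{Ker}(A_k)$, $\lambda_{\rm ker,min}(P_k^{-1}A_k)$ and $\lambda_{\rm ker,max}(P_k^{-1}A_k)$ denote the minimal and maximal, respectively, generalized eigenvalues $\lambda$ of $A_k u=\lambda P_k u$ restricted to (nonzero) vectors $u$ orthogonal to $\mathrm{Ker}(P_k)$; these are real. For a skew-symmetric matrix $B_k$ with $\mathrm{Ker}(P_k)\subseteq\mathrm{Ker}(B_k)$, $\lambda_{\rm ker,im,max}(P_k^{-1}B_k)$ denotes the maximal imaginary part of the generalized eigenvalues $\lambda\in\mathbb{C}$ of $B_k u=\lambda P_k u$ restricted to (nonzero, complex) vectors $u$ orthogonal to $\mathrm{Ker}(P_k)$; these eigenvalues are purely imaginary. The notation $P_k^{-1}$ is only symbolic when $P_k$ is singular (it can be read as the pseudoinverse). The sets $S_{P,j}$ may overlap; each is nonempty because $P$ is positive definite. *)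

theory Defs
  imports "HOL-Analysis.Analysis"
begin

definition symmetric_matrix :: "real^'n^'n \<Rightarrow> bool" where
  "symmetric_matrix M \<longleftrightarrow> transpose M = M"

definition skew_symmetric_matrix :: "real^'n^'n \<Rightarrow> bool" where
  "skew_symmetric_matrix M \<longleftrightarrow> transpose M = - M"

definition pos_semidefinite :: "real^'n^'n \<Rightarrow> bool" where
  "pos_semidefinite M \<longleftrightarrow> (\<forall>x. 0 \<le> x \<bullet> (M *v x))"

definition pos_definite :: "real^'n^'n \<Rightarrow> bool" where
  "pos_definite M \<longleftrightarrow> (\<forall>x. x \<noteq> 0 \<longrightarrow> 0 < x \<bullet> (M *v x))"

definition Ker :: "'a::semiring_1^'n^'m \<Rightarrow> ('a^'n) set" where
  "Ker M = {x. M *v x = 0}"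

abbreviation complexify :: "real^'n^'m \<Rightarrow> complex^'n^'m" where
  "complexify \<equiv> map_matrix complex_of_real"

(* Needed because the library's inner product on complex^'n is real-valued,
   namely the real part of this one. *)
definition hermitian_inner :: "complex^'n \<Rightarrow> complex^'n \<Rightarrow> complex" where
  "hermitian_inner u v = (\<Sum>i\<in>UNIV. u $ i * cnj (v $ i))"

definition eigenvalue :: "complex^'n^'n \<Rightarrow> complex \<Rightarrow> bool" where
  "eigenvalue M l \<longleftrightarrow> (\<exists>u. u \<noteq> 0 \<and> M *v u = l *s u)"

(* The generalized eigenvalues of M u = l P u restricted to nonzero complex vectors u
   orthogonal to the kernel of P. *)
definition ker_eigenvalues :: "real^'n^'n \<Rightarrow> real^'n^'n \<Rightarrow> complex set" where
  "ker_eigenvalues P M =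
     {l. \<exists>u. u \<noteq> 0 \<and> (\<forall>v \<in> Ker (complexify P). hermitian_inner u v = 0) \<and>
             complexify M *v u = l *s (complexify P *v u)}"

(* If P is nonzero and symmetric positive semi-definite with Ker P contained in Ker M, then
   ker_eigenvalues P M is finite and nonempty, so that Min and Max below are taken over
   finite nonempty sets. It consists of real numbers if M is symmetric, in which case Re only
   changes the type, and of purely imaginary numbers if M is skew-symmetric. *)
definition lambda_ker_min :: "real^'n^'n \<Rightarrow> real^'n^'n \<Rightarrow> real" where
  "lambda_ker_min P M = Min (Re ` ker_eigenvalues P M)"

definition lambda_ker_max :: "real^'n^'n \<Rightarrow> real^'n^'n \<Rightarrow> real" where
  "lambda_ker_max P M = Max (Re ` ker_eigenvalues P M)"

definition lambda_ker_im_max :: "real^'n^'n \<Rightarrow> real^'n^'n \<Rightarrow> real" where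
  "lambda_ker_im_max P M = Max (Im ` ker_eigenvalues P M)"

definition row_support :: "nat \<Rightarrow> (nat \<Rightarrow> real^'n^'n) \<Rightarrow> 'n \<Rightarrow> nat set" where
  "row_support Nloc P j = {k \<in> {1..Nloc}. row j (P k) \<noteq> 0}"

definition alpha_min ::
  "nat \<Rightarrow> (nat \<Rightarrow> real^'n^'n) \<Rightarrow> (nat \<Rightarrow> real^'n^'n) \<Rightarrow> 'n \<Rightarrow> real" where
  "alpha_min Nloc P A j = Min ((\<lambda>k. lambda_ker_min (P k) (A k)) ` row_support Nloc P j)"

definition alpha_max ::
  "nat \<Rightarrow> (nat \<Rightarrow> real^'n^'n) \<Rightarrow> (nat \<Rightarrow> real^'n^'n) \<Rightarrow> 'n \<Rightarrow> real" where
  "alpha_max Nloc P A j = Max ((\<lambda>k. lambda_ker_max (P k) (A k)) ` row_support Nloc P j)"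

definition beta_max ::
  "nat \<Rightarrow> (nat \<Rightarrow> real^'n^'n) \<Rightarrow> (nat \<Rightarrow> real^'n^'n) \<Rightarrow> 'n \<Rightarrow> real" where
  "beta_max Nloc P B j = Max ((\<lambda>k. lambda_ker_im_max (P k) (B k)) ` row_support Nloc P j)"

end

theory Submission
  imports Defs
begin

text \<open>Pairing \<open>(A + B) u = l P u\<close> with \<open>u\<close>, the symmetric part gives \<open>Re l\<close> and the
  skew-symmetric part gives \<open>Im l\<close> as Rayleigh quotients; each is a weighted mean of the local
  quotients with weights \<open>u\<^sup>* P\<^sub>k u\<close>. A local quotient is bounded by its extrema, which are attained
  orthogonally to the kernel of \<open>P\<^sub>k\<close> and are generalized eigenvalues there. Everything is done over
  the reals, on complex vectors with the real part of the Hermitian inner product, for which both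
  \<open>A\<^sub>k\<close> and \<open>- i B\<^sub>k\<close> are self-adjoint.\<close>

section \<open>Self-adjoint semidefinite pencils on a real Euclidean space\<close>

definition real_gen_eigenvalues :: "('a::real_inner \<Rightarrow> 'a) \<Rightarrow> ('a \<Rightarrow> 'a) \<Rightarrow> real set" where
  "real_gen_eigenvalues S T =
     {l. \<exists>u. u \<noteq> 0 \<and> (\<forall>v. T v = 0 \<longrightarrow> u \<bullet> v = 0) \<and> S u = l *\<^sub>R T u}"

text \<open>Along the line \<open>u - t *\<^sub>R R u\<close> the form of \<open>R\<close> has no
  constant term and has linear coefficient \<open>- 2 * (R u \<bullet> R u)\<close>, so with
  \<open>R u\<close> nonzero it would become negative for small positive \<open>t\<close>.\<close>

lemma psd_selfadjoint_null:
  fixes R :: "'a::real_inner \<Rightarrow> 'a"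
  assumes "linear R" and sa: "\<And>x y. R x \<bullet> y = x \<bullet> R y"
    and psd: "\<And>x. 0 \<le> R x \<bullet> x" and "R u \<bullet> u = 0"
  shows "R u = 0"
proof (rule ccontr)
  assume nz: "R u \<noteq> 0"
  define v where "v = R u"
  define c where "c = R v \<bullet> v"
  have q: "0 \<le> - 2 * t * (v \<bullet> v) + t\<^sup>2 * c" for t
  proof -
    have "R (u - t *\<^sub>R v) \<bullet> (u - t *\<^sub>R v) = - 2 * t * (v \<bullet> v) + t\<^sup>2 * c"
      using assms(4) sa[of v u] linear_diff[OF assms(1)] linear_cmul[OF assms(1)]
      by (simp add: v_def c_def inner_diff_left inner_diff_right power2_eq_square inner_commute)
    then show ?thesis using psd by metis
  qed
  have vv: "v \<bullet> v > 0" using nz by (simp add: v_def)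
  have c0: "c \<ge> 0" using psd c_def by simp
  \<comment> \<open>The denominator \<open>c + 1\<close> stays positive when \<open>c = 0\<close>
    and makes \<open>t * c \<le> v \<bullet> v\<close>, so the quadratic term offsets at most half
    of the linear one.\<close>
  define t where "t = (v \<bullet> v) / (c + 1)"
  have t: "t > 0" using vv c0 by (simp add: t_def)
  have "t * c \<le> v \<bullet> v" using vv c0 by (simp add: t_def field_simps)
  then have "t * (t * c) \<le> t * (v \<bullet> v)" using t by simp
  moreover have "t * (v \<bullet> v) > 0" using t vv by simp
  moreover have "0 \<le> - 2 * (t * (v \<bullet> v)) + t * (t * c)"
    using q[of t] by (simp add: power2_eq_square mult.assoc)
  ultimately show False by linarith
qed

text \<open>\<open>T\<close> stands for some \<open>Pk k\<close>, and \<open>S\<close> for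
  \<open>Ak k\<close> or for \<open>-\<i>\<close> times \<open>Bk k\<close>, acting on complex
  vectors seen as a real space. Together with self-adjointness, \<open>ker\<close> makes both
  quadratic forms blind to the kernel component of a vector.\<close>

locale semidefinite_pencil =
  fixes S T :: "'a::euclidean_space \<Rightarrow> 'a"
  assumes lin_S: "linear S" and lin_T: "linear T"
    and sa_S: "S x \<bullet> y = x \<bullet> S y" and sa_T: "T x \<bullet> y = x \<bullet> T y"
    and psd_T: "0 \<le> T x \<bullet> x"
    and ker: "T x = 0 \<Longrightarrow> S x = 0"
begin

text \<open>A vanishing form would put \<open>u\<close> in the kernel of \<open>T\<close>, hence
  make it orthogonal to itself.\<close>

lemma T_pos: "0 < T u \<bullet> u" if "u \<noteq> 0" "\<forall>v. T v = 0 \<longrightarrow> u \<bullet> v = 0"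
proof -
  have "T u \<bullet> u \<noteq> 0"
    using psd_selfadjoint_null[OF lin_T sa_T psd_T, of u] that by auto
  then show ?thesis using psd_T[of u] by simp
qed

text \<open>Eigenvectors for distinct eigenvalues are orthogonal for the form of \<open>T\<close>,
  which is positive on each of them. They are therefore linearly independent, and the dimension
  bounds their number.\<close>

lemma finite_real_gen_eigenvalues: "finite (real_gen_eigenvalues S T)"
proof -
  let ?G = "real_gen_eigenvalues S T"
  have "\<forall>l\<in>?G. \<exists>u. u \<noteq> 0 \<and> (\<forall>v. T v = 0 \<longrightarrow> u \<bullet> v = 0) \<and> S u = l *\<^sub>R T u"
    by (auto simp: real_gen_eigenvalues_def)
  then obtain f where f: "\<And>l. l \<in> ?G \<Longrightarrow> f l \<noteq> 0"
    "\<And>l v. l \<in> ?G \<Longrightarrow> T v = 0 \<Longrightarrow> f l \<bullet> v = 0"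
    "\<And>l. l \<in> ?G \<Longrightarrow> S (f l) = l *\<^sub>R T (f l)"
    by metis
  have pos: "0 < T (f l) \<bullet> f l" if "l \<in> ?G" for l
    using T_pos f that by blast
  have orth: "T (f l) \<bullet> f m = 0" if "l \<in> ?G" "m \<in> ?G" "l \<noteq> m" for l m
  proof -
    have "l * (T (f l) \<bullet> f m) = m * (T (f l) \<bullet> f m)"
      using sa_S[of "f l" "f m"] sa_T[of "f l" "f m"] f(3) that by simp
    then show ?thesis using that by simp
  qed
  have inj: "inj_on f ?G"
    using pos orth by (metis inj_onI less_irrefl)
  have "independent (f ` ?G)"
    unfolding dependent_def
  proof
    assume "\<exists>a\<in>f ` ?G. a \<in> span (f ` ?G - {a})"
    then obtain l where l: "l \<in> ?G" "f l \<in> span (f ` ?G - {f l})" by blast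
    \<comment> \<open>The other eigenvectors all lie in the hyperplane with normal
      \<open>T (f l)\<close>, but \<open>f l\<close> itself does not.\<close>
    have "f ` ?G - {f l} \<subseteq> {w. T (f l) \<bullet> w = 0}"
      using orth[OF l(1)] by auto
    then have "span (f ` ?G - {f l}) \<subseteq> {w. T (f l) \<bullet> w = 0}"
      by (rule span_minimal) (rule subspace_hyperplane)
    then show False using l pos[OF l(1)] by auto
  qed
  then have "finite (f ` ?G)" by (rule finiteI_independent)
  then show ?thesis using inj by (rule finite_imageD)
qed

text \<open>Compactness gives a maximizer of the Rayleigh quotient on the unit sphere of the
  complement of the kernel. The operator \<open>M T - S\<close> is then semidefinite and its form
  vanishes at the maximizer, so it annihilates that vector: the eigenvalue equation, obtained
  without differentiation.\<close>

lemma rayleigh_maximum_attained: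
  assumes "T w \<noteq> 0"
  obtains M where "M \<in> real_gen_eigenvalues S T" "\<And>u. S u \<bullet> u \<le> M * (T u \<bullet> u)"
proof -
  define V where "V = {u. \<forall>v. T v = 0 \<longrightarrow> u \<bullet> v = 0}"
  define K where "K = V \<inter> sphere 0 1"
  have subK: "subspace {v. T v = 0}"
    using linear_subspace_kernel[OF lin_T] .
  have V_eq: "V = {v. T v = 0}\<^sup>\<bottom>"
    by (auto simp: V_def orthogonal_comp_def orthogonal_def inner_commute)
  have subV: "subspace V"
    unfolding V_eq by (rule subspace_orthogonal_comp)
  have "compact K"
    unfolding K_def using closed_subspace[OF subV] compact_sphere by (rule closed_Int_compact)
  \<comment> \<open>By self-adjointness the range of \<open>T\<close> is orthogonal to its kernel,
    so \<open>w\<close> supplies a unit vector in \<open>K\<close>.\<close>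
  have "T w \<in> V" unfolding V_def using sa_T[of w] by simp
  then have "T w /\<^sub>R norm (T w) \<in> K"
    using assms subspace_scale[OF subV] by (simp add: K_def)
  then have "K \<noteq> {}" by blast
  have posK: "0 < T u \<bullet> u" if "u \<in> K" for u
    using that T_pos[of u] by (cases "u = 0") (auto simp: K_def V_def)
  have "continuous_on K (\<lambda>u. (S u \<bullet> u) / (T u \<bullet> u))"
  proof (intro continuous_on_divide continuous_on_inner continuous_on_id)
    show "continuous_on K S" "continuous_on K T"
      using lin_S lin_T by (simp_all add: linear_continuous_on linear_conv_bounded_linear)
    show "\<forall>u\<in>K. T u \<bullet> u \<noteq> 0"
      using posK by (metis less_irrefl)
  qed
  from continuous_attains_sup[OF \<open>compact K\<close> \<open>K \<noteq> {}\<close> this] obtain u0 where u0: "u0 \<in> K"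
    "\<And>u. u \<in> K \<Longrightarrow> (S u \<bullet> u) / (T u \<bullet> u) \<le> (S u0 \<bullet> u0) / (T u0 \<bullet> u0)"
    by blast
  define M where "M = (S u0 \<bullet> u0) / (T u0 \<bullet> u0)"
  have leK: "S u \<bullet> u \<le> M * (T u \<bullet> u)" if "u \<in> K" for u
    using u0(2)[OF that] posK[OF that] by (simp add: M_def[symmetric] pos_divide_le_eq)
  have leV: "S u \<bullet> u \<le> M * (T u \<bullet> u)" if "u \<in> V" for u
  proof (cases "u = 0")
    case True
    then show ?thesis by simp
  next
    case False
    let ?e = "u /\<^sub>R norm u"
    have "?e \<in> K" using False subspace_scale[OF subV that] by (simp add: K_def)
    from leK[OF this] have "(S u \<bullet> u) / (norm u)\<^sup>2 \<le> (M * (T u \<bullet> u)) / (norm u)\<^sup>2"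
      by (simp add: linear_cmul[OF lin_S] linear_cmul[OF lin_T] power2_eq_square divide_simps)
    then show ?thesis using False by (simp add: divide_le_cancel)
  qed
  have le: "S u \<bullet> u \<le> M * (T u \<bullet> u)" for u
  proof -
    \<comment> \<open>For the kernel component \<open>x\<close> both \<open>T x\<close> and
      \<open>S x\<close> vanish, so only \<open>y\<close> remains in the two forms.\<close>
    obtain x y where xy: "x \<in> {v. T v = 0}" "y \<in> V" "u = x + y"
      using subspace_sum_orthogonal_comp[OF subK] unfolding V_eq
      by (metis UNIV_I set_plus_elim)
    have "S u \<bullet> u = S y \<bullet> y" "T u \<bullet> u = T y \<bullet> y"
      using xy ker[of x] sa_S[of y x] sa_T[of y x]
      by (simp_all add: linear_add[OF lin_S] linear_add[OF lin_T] inner_add_right)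
    then show ?thesis using leV[OF xy(2)] by simp
  qed
  define R where "R = (\<lambda>u. M *\<^sub>R T u - S u)"
  have "R u0 = 0"
  proof (rule psd_selfadjoint_null[of R])
    show "linear R"
      unfolding R_def by (intro linear_compose_sub linear_compose_scale_right lin_S lin_T)
    show "R x \<bullet> y = x \<bullet> R y" for x y
      by (simp add: R_def inner_diff_left inner_diff_right sa_S sa_T)
    show "0 \<le> R x \<bullet> x" for x
      using le by (simp add: R_def inner_diff_left)
    show "R u0 \<bullet> u0 = 0"
      using posK[OF u0(1)] by (simp add: R_def inner_diff_left M_def)
  qed
  then have "M \<in> real_gen_eigenvalues S T"
    using u0(1) by (auto simp: real_gen_eigenvalues_def R_def K_def V_def intro!: exI[of _ u0])
  with le show thesis using that by blast
qed

lemma rayleigh_le_Max: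
  assumes "T w \<noteq> 0"
  shows "S u \<bullet> u \<le> Max (real_gen_eigenvalues S T) * (T u \<bullet> u)"
proof -
  obtain M where M: "M \<in> real_gen_eigenvalues S T" "S u \<bullet> u \<le> M * (T u \<bullet> u)"
    using rayleigh_maximum_attained[OF assms] by metis
  have "M \<le> Max (real_gen_eigenvalues S T)"
    using finite_real_gen_eigenvalues M(1) by (rule Max_ge)
  then show ?thesis using M(2) psd_T[of u] by (meson mult_right_mono order_trans)
qed

text \<open>The maximum result is applied to \<open>- S\<close>, whose generalized eigenvalues are
  the negatives of those of \<open>S\<close>.\<close>

lemma Min_le_rayleigh:
  assumes "T w \<noteq> 0"
  shows "Min (real_gen_eigenvalues S T) * (T u \<bullet> u) \<le> S u \<bullet> u"
proof -
  interpret neg: semidefinite_pencil "\<lambda>x. - S x" T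
    using linear_compose_neg[OF lin_S] lin_T sa_S sa_T psd_T ker
    by (simp add: semidefinite_pencil_def)
  obtain M where M: "M \<in> real_gen_eigenvalues (\<lambda>x. - S x) T" "- S u \<bullet> u \<le> M * (T u \<bullet> u)"
    using neg.rayleigh_maximum_attained[OF assms] by metis
  then obtain v where "v \<noteq> 0" "\<forall>w. T w = 0 \<longrightarrow> v \<bullet> w = 0" "- S v = M *\<^sub>R T v"
    by (auto simp: real_gen_eigenvalues_def)
  moreover from this(3) have "S v = (- M) *\<^sub>R T v"
    by (metis minus_minus scaleR_minus_left)
  ultimately have "- M \<in> real_gen_eigenvalues S T"
    unfolding real_gen_eigenvalues_def by blast
  with finite_real_gen_eigenvalues have "Min (real_gen_eigenvalues S T) \<le> - M" by (rule Min_le)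
  then have "Min (real_gen_eigenvalues S T) * (T u \<bullet> u) \<le> - M * (T u \<bullet> u)"
    using psd_T[of u] by (rule mult_right_mono)
  then show ?thesis using M(2) by simp
qed

end

section \<open>Real matrices acting on complex vectors\<close>

lemma Ker_complexify_iff:
  "complexify M *v u = 0 \<longleftrightarrow> M *v (\<chi> i. Re (u $ i)) = 0 \<and> M *v (\<chi> i. Im (u $ i)) = 0"
  by (auto simp: vec_eq_iff matrix_vector_mult_def map_matrix_def complex_eq_iff)

lemma complexify_inner_self:
  "(complexify M *v u) \<bullet> u =
    (\<chi> i. Re (u $ i)) \<bullet> (M *v (\<chi> i. Re (u $ i))) + (\<chi> i. Im (u $ i)) \<bullet> (M *v (\<chi> i. Im (u $ i)))"
  by (simp add: inner_vec_def inner_complex_def matrix_vector_mult_def map_matrix_def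
      sum.distrib mult.commute)

lemma complexify_inner:
  "(complexify M *v x) \<bullet> y = x \<bullet> (complexify (transpose M) *v y)"
proof -
  have *: "(complex_of_real a * z) \<bullet> w = a * (z \<bullet> w)" "w \<bullet> (complex_of_real a * z) = a * (w \<bullet> z)" for a z w
    by (simp_all add: inner_complex_def algebra_simps)
  show ?thesis
    unfolding inner_vec_def matrix_vector_mult_def map_matrix_def transpose_def
    by (simp add: inner_sum_left inner_sum_right *) (rule sum.swap)
qed

lemma linear_complexify: "linear ((*v) (complexify M))"
  by (rule linearI, rule matrix_vector_right_distrib)
    (simp add: vec_eq_iff matrix_vector_mult_def scaleR_sum_right)

lemma linear_cscale: "linear ((*s) (c::complex))"
  by (rule linearI) (simp_all add: vec_eq_iff algebra_simps)

lemma complexify_add: "complexify (M + N) = complexify M + complexify N"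
  by (simp add: vec_eq_iff map_matrix_def)

lemma complexify_uminus: "complexify (- M) *v u = - (complexify M *v u)"
  by (simp add: vec_eq_iff map_matrix_def matrix_vector_mult_def sum_negf)

lemma complexify_mult: "complexify (M ** N) = complexify M ** complexify N"
  by (simp add: vec_eq_iff map_matrix_def matrix_matrix_mult_def)

lemma complexify_sum_mult:
  "complexify (\<Sum>k\<in>I. M k) *v u = (\<Sum>k\<in>I. complexify (M k) *v u)"
proof (induction I rule: infinite_finite_induct)
  case (insert k I)
  then show ?case by (simp add: complexify_add matrix_vector_mult_add_rdistrib)
qed (simp_all add: vec_eq_iff map_matrix_def matrix_vector_mult_def)

lemma inner_eq_Re_hermitian: "u \<bullet> v = Re (hermitian_inner u v)"
  by (simp add: inner_vec_def hermitian_inner_def inner_complex_def)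

lemma hermitian_inner_imaginary: "Re (hermitian_inner u (\<i> *s v)) = Im (hermitian_inner u v)"
  by (simp add: hermitian_inner_def)

lemma inner_ii: "(\<i> *s x) \<bullet> y = - (x \<bullet> (\<i> *s y))" for x y :: "complex^'n"
  by (simp add: inner_vec_def inner_complex_def sum_negf[symmetric] algebra_simps)

text \<open>Up to sign the left side is the imaginary part of the Hermitian form of \<open>S\<close>
  at \<open>u\<close>. It vanishes because \<open>S\<close> is self-adjoint and commutes with the
  skew-adjoint multiplication by \<open>\<i>\<close>.\<close>

lemma inner_ii_selfadjoint:
  fixes S :: "complex^'n \<Rightarrow> complex^'n"
  assumes "\<And>x y. S x \<bullet> y = x \<bullet> S y" "\<And>x. S (\<i> *s x) = \<i> *s S x"
  shows "(\<i> *s S u) \<bullet> u = 0"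
proof -
  have "(\<i> *s S u) \<bullet> u = (\<i> *s u) \<bullet> S u"
    using assms(1)[of "\<i> *s u" u] unfolding assms(2) .
  also have "\<dots> = - ((\<i> *s S u) \<bullet> u)"
    using inner_ii[of u "S u"] inner_commute[of u "\<i> *s S u"] by linarith
  finally show ?thesis by linarith
qed

text \<open>The complex kernel is closed under multiplication by \<open>\<i>\<close>, and the real
  products of \<open>u\<close> with \<open>v\<close> and \<open>\<i> *s v\<close> are the real and
  imaginary parts of the Hermitian one.\<close>

lemma orthogonal_complexify_Ker_iff:
  "(\<forall>v\<in>Ker (complexify P). hermitian_inner u v = 0) \<longleftrightarrow>
   (\<forall>v. complexify P *v v = 0 \<longrightarrow> u \<bullet> v = 0)" (is "?L \<longleftrightarrow> ?R")
proof
  assume ?R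
  show ?L
  proof
    fix v assume "v \<in> Ker (complexify P)"
    then have v: "complexify P *v v = 0" by (simp add: Ker_def)
    then have "complexify P *v (\<i> *s v) = 0" by (simp add: vector_scalar_commute)
    with v \<open>?R\<close> have "u \<bullet> v = 0" "u \<bullet> (\<i> *s v) = 0" by blast+
    then show "hermitian_inner u v = 0"
      by (simp add: inner_eq_Re_hermitian hermitian_inner_imaginary complex_eq_iff)
  qed
qed (simp add: inner_eq_Re_hermitian Ker_def)

section \<open>Complex generalized eigenvalues as eigenvalues of real pencils\<close>

lemma pencil_symmetric:
  assumes "symmetric_matrix P" "pos_semidefinite P" "symmetric_matrix A" "Ker P \<subseteq> Ker A"
  shows "semidefinite_pencil ((*v) (complexify A)) ((*v) (complexify P))"
proof (rule semidefinite_pencil.intro)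
  show "(complexify A *v x) \<bullet> y = x \<bullet> (complexify A *v y)"
    and "(complexify P *v x) \<bullet> y = x \<bullet> (complexify P *v y)" for x y
    using assms by (simp_all add: complexify_inner symmetric_matrix_def)
  show "0 \<le> (complexify P *v x) \<bullet> x" for x
    using assms by (simp add: complexify_inner_self pos_semidefinite_def)
  show "complexify A *v x = 0" if "complexify P *v x = 0" for x
    using that assms by (auto simp: Ker_complexify_iff Ker_def)
qed (rule linear_complexify)+

text \<open>Two signs cancel: transposing \<open>B\<close> gives one, moving \<open>\<i>\<close>
  across the inner product the other.\<close>

lemma pencil_skew:
  assumes "symmetric_matrix P" "pos_semidefinite P" "skew_symmetric_matrix B" "Ker P \<subseteq> Ker B"
  shows "semidefinite_pencil (\<lambda>x. (-\<i>) *s (complexify B *v x)) ((*v) (complexify P))"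
proof (rule semidefinite_pencil.intro)
  show "linear (\<lambda>x. (-\<i>) *s (complexify B *v x))"
    using linear_compose[OF linear_complexify linear_cscale, of "-\<i>" B] unfolding o_def .
  show "((-\<i>) *s (complexify B *v x)) \<bullet> y = x \<bullet> ((-\<i>) *s (complexify B *v y))" for x y
    using assms inner_ii[of "complexify B *v x" y]
    by (simp add: complexify_inner skew_symmetric_matrix_def complexify_uminus vector_scalar_commute
       vector_smult_lneg)
  show "(complexify P *v x) \<bullet> y = x \<bullet> (complexify P *v y)" for x y
    using assms by (simp_all add: complexify_inner symmetric_matrix_def)
  show "0 \<le> (complexify P *v x) \<bullet> x" for x
    using assms by (simp add: complexify_inner_self pos_semidefinite_def)
  show "(-\<i>) *s (complexify B *v x) = 0" if "complexify P *v x = 0" for x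
    using that assms by (auto simp: Ker_complexify_iff Ker_def)
qed (rule linear_complexify)

text \<open>Multiplying the equation by \<open>\<i>\<close> and pairing with \<open>u\<close>
  leaves, up to sign, only \<open>Im l\<close> times the form of \<open>P\<close>, which is positive
  by \<open>T_pos\<close>.\<close>

lemma complex_gen_eigenvalue_real:
  assumes "semidefinite_pencil S ((*v) (complexify P))" "\<And>x. S (\<i> *s x) = \<i> *s S x"
    and "u \<noteq> 0" "\<forall>v. complexify P *v v = 0 \<longrightarrow> u \<bullet> v = 0"
    and eq: "S u = l *s (complexify P *v u)"
  shows "Im l = 0"
proof -
  interpret semidefinite_pencil S "(*v) (complexify P)" by fact
  let ?p = "complexify P *v u"
  have "(\<i> *s S u) \<bullet> u = 0"
    by (rule inner_ii_selfadjoint) (auto simp: sa_S assms(2))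
  moreover have "(\<i> *s ?p) \<bullet> u = 0"
    by (rule inner_ii_selfadjoint) (auto simp: sa_T vector_scalar_commute)
  moreover have "\<i> *s S u = Re l *\<^sub>R (\<i> *s ?p) - Im l *\<^sub>R ?p"
    unfolding eq by (simp add: vec_eq_iff complex_eq_iff algebra_simps)
  ultimately have "Im l * (?p \<bullet> u) = 0"
    by (simp add: inner_diff_left)
  then show ?thesis using T_pos[of u] assms by auto
qed

text \<open>Links the complex, Hermitian notion to the real one: the a priori complex eigenvalues
  are real, and the two kinds of orthogonality to the kernel agree.\<close>

lemma Re_complex_gen_eigenvalues:
  assumes "semidefinite_pencil S ((*v) (complexify P))" "\<And>x. S (\<i> *s x) = \<i> *s S x"
  shows "real_gen_eigenvalues S ((*v) (complexify P)) =
    Re ` {l. \<exists>u. u \<noteq> 0 \<and> (\<forall>v\<in>Ker (complexify P). hermitian_inner u v = 0) \<and>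
             S u = l *s (complexify P *v u)}" (is "?G = Re ` ?E")
proof
  have scale: "complex_of_real r *s x = r *\<^sub>R x" for r and x :: "complex^'n"
    by (simp add: vec_eq_iff complex_eq_iff)
  show "?G \<subseteq> Re ` ?E"
  proof
    fix l assume "l \<in> ?G"
    then have "complex_of_real l \<in> ?E"
      by (auto simp: real_gen_eigenvalues_def scale orthogonal_complexify_Ker_iff)
    then show "l \<in> Re ` ?E" by force
  qed
  show "Re ` ?E \<subseteq> ?G"
  proof
    fix r assume "r \<in> Re ` ?E"
    then obtain l u where *: "r = Re l" "u \<noteq> 0" "\<forall>v. complexify P *v v = 0 \<longrightarrow> u \<bullet> v = 0"
      "S u = l *s (complexify P *v u)"
      by (auto simp: orthogonal_complexify_Ker_iff)
    then have "l = complex_of_real r"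
      using complex_gen_eigenvalue_real[OF assms *(2-4)] by (simp add: complex_eq_iff)
    then show "r \<in> ?G" using * scale[of "Re l" "complexify P *v u"]
      unfolding real_gen_eigenvalues_def by auto
  qed
qed

lemma Re_ker_eigenvalues_symmetric:
  assumes "symmetric_matrix P" "pos_semidefinite P" "symmetric_matrix A" "Ker P \<subseteq> Ker A"
  shows "Re ` ker_eigenvalues P A =
    real_gen_eigenvalues ((*v) (complexify A)) ((*v) (complexify P))"
  using Re_complex_gen_eigenvalues[OF pencil_symmetric[OF assms]]
  by (simp add: vector_scalar_commute ker_eigenvalues_def)

text \<open>\<open>l\<close> is an eigenvalue for \<open>B\<close> exactly when
  \<open>- \<i> * l\<close> is one for \<open>-\<i>\<close> times \<open>B\<close>, and the real
  part of \<open>- \<i> * l\<close> is \<open>Im l\<close>.\<close>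

lemma Im_ker_eigenvalues_skew:
  assumes "symmetric_matrix P" "pos_semidefinite P" "skew_symmetric_matrix B" "Ker P \<subseteq> Ker B"
  shows "Im ` ker_eigenvalues P B =
    real_gen_eigenvalues (\<lambda>x. (-\<i>) *s (complexify B *v x)) ((*v) (complexify P))"
proof -
  have rot: "(-\<i>) *s x = l *s y \<longleftrightarrow> x = (\<i> * l) *s y" for x y :: "complex^'n" and l
  proof
    assume "(-\<i>) *s x = l *s y"
    then have "\<i> *s ((-\<i>) *s x) = \<i> *s (l *s y)" by (rule arg_cong)
    then show "x = (\<i> * l) *s y" by (simp add: vector_smult_assoc)
  qed (simp add: vector_smult_assoc)
  have "Im ` ker_eigenvalues P B =
    Re ` {l. \<exists>u. u \<noteq> 0 \<and> (\<forall>v\<in>Ker (complexify P). hermitian_inner u v = 0) \<and>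
             (-\<i>) *s (complexify B *v u) = l *s (complexify P *v u)}" (is "_ = Re ` ?E")
  proof -
    have "ker_eigenvalues P B = (\<lambda>l. \<i> * l) ` ?E"
    proof (intro set_eqI iffI)
      fix l assume "l \<in> ker_eigenvalues P B"
      then have "- \<i> * l \<in> ?E" by (simp only: ker_eigenvalues_def rot mem_Collect_eq) simp
      then show "l \<in> (\<lambda>l. \<i> * l) ` ?E" by (rule rev_image_eqI) simp
    next
      fix l assume "l \<in> (\<lambda>l. \<i> * l) ` ?E"
      then obtain m where "l = \<i> * m" "m \<in> ?E" by blast
      then show "l \<in> ker_eigenvalues P B"
        by (simp only: ker_eigenvalues_def rot mem_Collect_eq)
    qed
    then show ?thesis by (simp add: image_image)
  qed
  also have "\<dots> = real_gen_eigenvalues (\<lambda>x. (-\<i>) *s (complexify B *v x)) ((*v) (complexify P))"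
    by (rule Re_complex_gen_eigenvalues[OF pencil_skew[OF assms], symmetric])
      (simp add: vector_scalar_commute vector_smult_assoc)
  finally show ?thesis .
qed

section \<open>Rayleigh bounds for the local matrices\<close>

lemma complexify_nonzero:
  assumes "M \<noteq> 0"
  obtains w where "complexify M *v w \<noteq> 0"
proof -
  have "complexify M \<noteq> 0" using assms by (auto simp: vec_eq_iff map_matrix_def)
  then show thesis using that matrix_eq[of "complexify M" 0] by (metis matrix_vector_mult_0)
qed

text \<open>The quotients are kept multiplied out because \<open>u\<close> is an arbitrary complex
  vector, at which the form of \<open>P\<close> may vanish.\<close>

lemma local_bounds_symmetric:
  assumes "symmetric_matrix P" "pos_semidefinite P" "symmetric_matrix A" "Ker P \<subseteq> Ker A"
    and "P \<noteq> 0"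
  shows "lambda_ker_min P A * ((complexify P *v u) \<bullet> u) \<le> (complexify A *v u) \<bullet> u"
    and "(complexify A *v u) \<bullet> u \<le> lambda_ker_max P A * ((complexify P *v u) \<bullet> u)"
proof -
  interpret semidefinite_pencil "(*v) (complexify A)" "(*v) (complexify P)"
    by (rule pencil_symmetric) fact+
  obtain w where "complexify P *v w \<noteq> 0" using complexify_nonzero[OF \<open>P \<noteq> 0\<close>] .
  note Min_le_rayleigh[OF this] rayleigh_le_Max[OF this]
  then show "lambda_ker_min P A * ((complexify P *v u) \<bullet> u) \<le> (complexify A *v u) \<bullet> u"
    and "(complexify A *v u) \<bullet> u \<le> lambda_ker_max P A * ((complexify P *v u) \<bullet> u)"
    by (simp_all add: lambda_ker_min_def lambda_ker_max_def Re_ker_eigenvalues_symmetric[OF assms(1-4)])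
qed

text \<open>Replacing \<open>u\<close> by its complex conjugate changes the sign of \<open>Im (u\<^sup>* B u)\<close> and preserves
  \<open>u\<^sup>* P u\<close>, which gives the lower bound.\<close>

lemma local_bounds_skew:
  fixes P B :: "real^'n^'n"
  assumes "symmetric_matrix P" "pos_semidefinite P" "skew_symmetric_matrix B" "Ker P \<subseteq> Ker B"
    and "P \<noteq> 0"
  shows "\<bar>((-\<i>) *s (complexify B *v u)) \<bullet> u\<bar> \<le> lambda_ker_im_max P B * ((complexify P *v u) \<bullet> u)"
proof -
  interpret semidefinite_pencil "\<lambda>x. (-\<i>) *s (complexify B *v x)" "(*v) (complexify P)"
    by (rule pencil_skew) fact+
  obtain w where "complexify P *v w \<noteq> 0" using complexify_nonzero[OF \<open>P \<noteq> 0\<close>] .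
  note rayleigh_le_Max[OF this]
  then have le: "((-\<i>) *s (complexify B *v x)) \<bullet> x
      \<le> lambda_ker_im_max P B * ((complexify P *v x) \<bullet> x)" for x
    by (simp add: lambda_ker_im_max_def Im_ker_eigenvalues_skew[OF assms(1-4)])
  define c :: "complex^'n" where "c = (\<chi> i. cnj (u $ i))"
  have cnj: "(complexify M *v c) $ i = cnj ((complexify M *v u) $ i)" for M i
    by (simp add: c_def matrix_vector_mult_def map_matrix_def)
  have "(complexify P *v c) \<bullet> c = (complexify P *v u) \<bullet> u"
    unfolding inner_vec_def cnj by (simp add: c_def inner_complex_def)
  moreover have "((-\<i>) *s (complexify B *v c)) \<bullet> c = - (((-\<i>) *s (complexify B *v u)) \<bullet> u)"
    unfolding inner_vec_def vector_smult_component cnj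
    by (simp add: c_def inner_complex_def sum_negf[symmetric] algebra_simps)
  ultimately show ?thesis using le[of u] le[of c] by simp
qed

section \<open>The global eigenvalue problem in generalized form\<close>

lemma pos_definite_invertible:
  assumes "pos_definite P"
  shows "P ** matrix_inv P = mat 1"
proof -
  have "\<forall>x. P *v x = 0 \<longrightarrow> x = 0"
    using assms unfolding pos_definite_def by (metis inner_zero_right less_irrefl)
  then have "invertible P"
    by (simp add: invertible_left_inverse matrix_left_invertible_ker)
  \<comment> \<open>\<open>matrix_inv\<close> is a choice, so its two-sided inverse law comes from
    the existence of some inverse.\<close>
  then have "P ** matrix_inv P = mat 1 \<and> matrix_inv P ** P = mat 1"
    unfolding invertible_def matrix_inv_def by (rule someI_ex)
  then show ?thesis ..
qed

lemma generalized_eigenvector_exists: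
  assumes "pos_definite P" "eigenvalue (complexify (matrix_inv P ** M)) l"
  obtains u where "u \<noteq> 0" "complexify M *v u = l *s (complexify P *v u)"
proof -
  obtain u where u: "u \<noteq> 0" "complexify (matrix_inv P ** M) *v u = l *s u"
    using assms(2) by (auto simp: eigenvalue_def)
  have "complexify M *v u = complexify (P ** (matrix_inv P ** M)) *v u"
    by (simp add: matrix_mul_assoc pos_definite_invertible[OF assms(1)])
  also have "\<dots> = complexify P *v (l *s u)"
    unfolding complexify_mult[of P] u(2)[symmetric] by (simp add: matrix_vector_mul_assoc)
  finally show thesis using that u(1) by (simp add: vector_scalar_commute)
qed

lemma pos_definite_complexify:
  assumes "pos_definite P" "u \<noteq> 0"
  shows "0 < (complexify P *v u) \<bullet> u"
proof -
  have "(\<chi> i. Re (u $ i)) \<noteq> 0 \<or> (\<chi> i. Im (u $ i)) \<noteq> 0"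
    using assms(2) by (auto simp: vec_eq_iff complex_eq_iff)
  moreover have "0 \<le> x \<bullet> (P *v x)" for x
    using assms(1) by (cases "x = 0") (auto simp: pos_definite_def less_imp_le)
  ultimately show ?thesis
    using assms(1) unfolding complexify_inner_self pos_definite_def
    by (meson add_nonneg_pos add_pos_nonneg)
qed

section \<open>Extrema over the row supports\<close>

lemma row_support_cover:
  assumes "k \<in> {1..Nloc}" "P k \<noteq> 0"
  obtains j where "k \<in> row_support Nloc P j"
  using assms that by (auto simp: row_support_def vec_eq_iff row_def)

lemma finite_row_support: "finite (row_support Nloc P j)"
  by (simp add: row_support_def)

text \<open>If another \<open>S i\<close> is empty, the unspecified \<open>Min\<close> of the empty
  set can only lower the outer minimum, so the bound stands.\<close>

lemma Min_range_Min_le: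
  fixes f :: "nat \<Rightarrow> real" and S :: "'n::finite \<Rightarrow> nat set"
  assumes "finite (S j)" "k \<in> S j"
  shows "Min (range (\<lambda>j. Min (f ` S j))) \<le> f k"
proof -
  have "Min (range (\<lambda>j. Min (f ` S j))) \<le> Min (f ` S j)" by (rule Min_le) auto
  also have "\<dots> \<le> f k" using assms by (intro Min_le) auto
  finally show ?thesis .
qed

lemma le_Max_range_Max:
  fixes f :: "nat \<Rightarrow> real" and S :: "'n::finite \<Rightarrow> nat set"
  assumes "finite (S j)" "k \<in> S j"
  shows "f k \<le> Max (range (\<lambda>j. Max (f ` S j)))"
proof -
  have "f k \<le> Max (f ` S j)" using assms by (intro Max_ge) auto
  also have "\<dots> \<le> Max (range (\<lambda>j. Max (f ` S j)))" by (rule Max_ge) auto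
  finally show ?thesis .
qed

section \<open>Assembly of the local bounds\<close>

theorem lemma2p6:
  fixes A B P :: "real^'n^'n"
    and Ak Bk Pk :: "nat \<Rightarrow> real^'n^'n"
    and Nloc :: nat
    and \<mu> \<xi> :: real
  assumes "Nloc \<ge> 1"
    and "symmetric_matrix A"
    and "skew_symmetric_matrix B"
    and "symmetric_matrix P" and "pos_definite P"
    and "A = (\<Sum>k=1..Nloc. Ak k)"
    and "B = (\<Sum>k=1..Nloc. Bk k)"
    and "P = (\<Sum>k=1..Nloc. Pk k)"
    and "\<And>k. k \<in> {1..Nloc} \<Longrightarrow> symmetric_matrix (Pk k)"
    and "\<And>k. k \<in> {1..Nloc} \<Longrightarrow> pos_semidefinite (Pk k)"
    and "\<And>k. k \<in> {1..Nloc} \<Longrightarrow> symmetric_matrix (Ak k)"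
    and "\<And>k. k \<in> {1..Nloc} \<Longrightarrow> skew_symmetric_matrix (Bk k)"
    and "\<And>k. k \<in> {1..Nloc} \<Longrightarrow> Ker (Pk k) \<subseteq> Ker (Ak k)"
    and "\<And>k. k \<in> {1..Nloc} \<Longrightarrow> Ker (Pk k) \<subseteq> Ker (Bk k)"
    and "eigenvalue (complexify (matrix_inv P ** (A + B))) (Complex \<mu> \<xi>)"
  shows "\<mu> \<in> {Min (range (alpha_min Nloc Pk Ak)) .. Max (range (alpha_max Nloc Pk Ak))} \<and>
         \<xi> \<in> {- Max (range (beta_max Nloc Pk Bk)) .. Max (range (beta_max Nloc Pk Bk))}"
proof -
  obtain u where u: "u \<noteq> 0"
    and eq: "complexify (A + B) *v u = Complex \<mu> \<xi> *s (complexify P *v u)"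
    using generalized_eigenvector_exists[OF assms(5,15)] .
  let ?p = "(complexify P *v u) \<bullet> u"
  let ?pk = "\<lambda>k. (complexify (Pk k) *v u) \<bullet> u"
  have pos: "0 < ?p" using pos_definite_complexify[OF assms(5) u] .
  have p: "?p = (\<Sum>k=1..Nloc. ?pk k)"
    unfolding assms(8) complexify_sum_mult by (rule inner_sum_left)
  \<comment> \<open>The eigenvalue is split into \<open>\<mu>\<close> and \<open>\<xi>\<close> so
    that pairing with \<open>u\<close> can isolate each in turn.\<close>
  have eq': "complexify A *v u + complexify B *v u =
      \<mu> *\<^sub>R (complexify P *v u) + \<xi> *\<^sub>R (\<i> *s (complexify P *v u))"
    using eq unfolding complexify_add matrix_vector_mult_add_rdistrib
    by (simp add: vec_eq_iff complex_eq_iff algebra_simps)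
  have sym0: "(\<i> *s (complexify M *v u)) \<bullet> u = 0" if "symmetric_matrix M" for M
    by (rule inner_ii_selfadjoint)
      (use that in \<open>simp_all add: complexify_inner symmetric_matrix_def vector_scalar_commute\<close>)
  have skew0: "(complexify B *v u) \<bullet> u = 0"
    using complexify_inner[of B u u] assms(3) inner_commute[of u "complexify B *v u"]
    by (simp add: skew_symmetric_matrix_def complexify_uminus)

  \<comment> \<open>Pairing with \<open>u\<close> removes the term of the skew-symmetric
    \<open>B\<close> and, since \<open>P\<close> is symmetric, the \<open>\<xi>\<close>
    term.\<close>
  have "(complexify A *v u) \<bullet> u = \<mu> * ?p"
    using arg_cong[OF eq', of "\<lambda>x. x \<bullet> u"] skew0 sym0[OF assms(4)]
    by (simp add: inner_add_left)
  then have mu: "\<mu> * ?p = (\<Sum>k=1..Nloc. (complexify (Ak k) *v u) \<bullet> u)"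
    unfolding assms(6) complexify_sum_mult by (simp add: inner_sum_left)
  \<comment> \<open>After multiplication by \<open>-\<i>\<close> the roles swap: pairing with
    \<open>u\<close> now removes \<open>A\<close> and the \<open>\<mu>\<close> term.\<close>
  have "(-\<i>) *s (complexify A *v u) + (-\<i>) *s (complexify B *v u) =
      - \<mu> *\<^sub>R (\<i> *s (complexify P *v u)) + \<xi> *\<^sub>R (complexify P *v u)"
    using arg_cong[OF eq', of "(*s) (-\<i>)"]
    by (simp add: vec_eq_iff complex_eq_iff algebra_simps)
  from arg_cong[OF this, of "\<lambda>x. x \<bullet> u"]
  have "((-\<i>) *s (complexify B *v u)) \<bullet> u = \<xi> * ?p"
    using sym0[OF assms(2)] sym0[OF assms(4)]
    by (simp add: inner_add_left inner_diff_left)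
  then have xi: "\<xi> * ?p = (\<Sum>k=1..Nloc. ((-\<i>) *s (complexify (Bk k) *v u)) \<bullet> u)"
    unfolding assms(7) complexify_sum_mult
      linear_sum[OF linear_cscale[of "-\<i>"]] by (simp add: inner_sum_left)

  have pk: "0 \<le> ?pk k" if "k \<in> {1..Nloc}" for k
    using assms(10)[OF that] by (simp add: complexify_inner_self pos_semidefinite_def)
  \<comment> \<open>An index with \<open>Pk k = 0\<close> lies in no row support and enters no
    extremum; the kernel inclusions make its contributions vanish.\<close>
  have zero: "complexify (Pk k) *v u = 0" "complexify (Ak k) *v u = 0" "complexify (Bk k) *v u = 0"
    if "k \<in> {1..Nloc}" "Pk k = 0" for k
    using assms(13,14)[OF that(1)] that(2) by (auto simp: Ker_complexify_iff Ker_def)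

  have bounds: "Min (range (alpha_min Nloc Pk Ak)) * ?pk k \<le> (complexify (Ak k) *v u) \<bullet> u \<and>
    (complexify (Ak k) *v u) \<bullet> u \<le> Max (range (alpha_max Nloc Pk Ak)) * ?pk k \<and>
    \<bar>((-\<i>) *s (complexify (Bk k) *v u)) \<bullet> u\<bar> \<le> Max (range (beta_max Nloc Pk Bk)) * ?pk k"
    if k: "k \<in> {1..Nloc}" for k
  proof (cases "Pk k = 0")
    case True
    then show ?thesis using zero[OF k] by simp
  next
    case False
    \<comment> \<open>A nonzero matrix has a nonzero row, so the local constants of \<open>k\<close>
      enter the extrema for some \<open>j\<close>. As the weight \<open>?pk k\<close> is
      nonnegative, they may be replaced by the global extrema.\<close>
    then obtain j where j: "k \<in> row_support Nloc Pk j" using row_support_cover[OF k] by blast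
    note mono = mult_right_mono[OF _ pk[OF k]]
    have "Min (range (alpha_min Nloc Pk Ak)) \<le> lambda_ker_min (Pk k) (Ak k)"
      unfolding alpha_min_def by (rule Min_range_Min_le[of "row_support Nloc Pk", OF finite_row_support j])
    moreover have "lambda_ker_max (Pk k) (Ak k) \<le> Max (range (alpha_max Nloc Pk Ak))"
      unfolding alpha_max_def by (rule le_Max_range_Max[of "row_support Nloc Pk", OF finite_row_support j])
    moreover have "lambda_ker_im_max (Pk k) (Bk k) \<le> Max (range (beta_max Nloc Pk Bk))"
      unfolding beta_max_def by (rule le_Max_range_Max[of "row_support Nloc Pk", OF finite_row_support j])
    ultimately show ?thesis
      using local_bounds_symmetric[OF assms(9,10,11,13)[OF k] False, of u]
        local_bounds_skew[OF assms(9,10,12,14)[OF k] False, of u] mono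
      by (meson order_trans)
  qed
  \<comment> \<open>Summation over \<open>k\<close> turns the weights into \<open>?p\<close>.
    \<open>mu\<close> is unfolded first because its left side contains the \<open>?p\<close> that
    \<open>p\<close> expands.\<close>
  have "Min (range (alpha_min Nloc Pk Ak)) * ?p \<le> \<mu> * ?p"
    unfolding mu unfolding p sum_distrib_left using bounds by (blast intro: sum_mono)
  moreover have "\<mu> * ?p \<le> Max (range (alpha_max Nloc Pk Ak)) * ?p"
    unfolding mu unfolding p sum_distrib_left using bounds by (blast intro: sum_mono)
  moreover have "\<bar>\<xi> * ?p\<bar> \<le> Max (range (beta_max Nloc Pk Bk)) * ?p"
    unfolding xi unfolding p sum_distrib_left
    using bounds by (intro order_trans[OF sum_abs] sum_mono) blast
  then have "\<bar>\<xi>\<bar> \<le> Max (range (beta_max Nloc Pk Bk))"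
    using pos by (simp add: abs_mult)
  ultimately show ?thesis
    unfolding mult_le_cancel_right_pos[OF pos] atLeastAtMost_iff by linarith
qed

end
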